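(* Let $(\tau_n)_n$ be a sequence of positive real numbers with $\tau_n\to+\infty$. For any disjoint compact sets $K\subset\mathbb{C}\setminus\{0\}$ and $L\subset\mathbb{C}$ with connected complement, and for any bounded open set $U\subset\mathbb{C}$ containing $K$, there exist $\theta\in(0,1)$ and $N\in\mathbb{N}$ such that, for every $\varphi\in A(\overline{U})$ and every $n\ge N$, there exists a polynomial $P_n$ of the form $P_n(z)=\sum_{k=\lfloor n/\tau_n\rfloor}^{n}a_kz^k$ (with $a_k\in\mathbb{C}$) such that $$\|P_n\|_L\le\|\varphi\|_{\overline{U}}\,\theta^n\quad\text{and}\quad\|P_n-\varphi\|_K\le\|\varphi\|_{\overline{U}}\,\theta^n.$$
   Context: $\mathbb{N}$ is the set of non-negative integers, and $\lfloor x\rfloor$ is the integer part of $x$. "With connected complement" means that each of $\mathbb{C}\setminus K$ and $\mathbb{C}\setminus L$ is connected. For a compact set $X\subset\mathbb{C}$, $A(X)$ is the space of complex functions continuous on $X$ and holomorphic in the interior of $X$, and $\|\cdot\|_X$ is the supremum norm on $X$. *)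

theory Defs
  imports "HOL-Complex_Analysis.Complex_Analysis"
begin

definition A_space :: "complex set \<Rightarrow> (complex \<Rightarrow> complex) set" where
  "A_space X = {f. continuous_on X f \<and> f holomorphic_on interior X}"

(* The empty set is treated separately because Sup {} is an unspecified real.
   On a nonempty set this is the supremum norm provided f is bounded there;
   this holds for a continuous f on a compact X. *)
definition sup_norm_on :: "complex set \<Rightarrow> (complex \<Rightarrow> complex) \<Rightarrow> real" where
  "sup_norm_on X f = (if X = {} then 0 else (SUP z\<in>X. cmod (f z)))"

end

theory Submission
  imports Defs
begin

text \<open>Let $m = \lfloor n/\tau_n\rfloor$ and $V = U - L - \{0\}$. On $K$ the function $f(w) = \varphi(w)/w^m$ is the
Cauchy integral over a cycle $\Gamma$ in $V - K$ of line segments, and on $L$ the same integral vanishes. If polynomials $g_w$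
of degree at most $d = n - m$ approximate $z \mapsto 1/(w - z)$ on $K \cup L$ up to $C\theta^d$, uniformly in
$w \in \Gamma$, then replacing the kernel by $g_w$ turns the integral into a polynomial of degree at most $d$ in $z$.
Multiplying this polynomial by $z^m$ gives $P_n$; passing from $\varphi$ to $f$ and back costs only a factor $B^m$, which is
subexponential because $m = o(n)$.

Geometric approximation of the kernel needs a single polynomial $p$ with $|1 - (w - z)p(z)| \le 1/2$ on $K \cup L$: the
partial sums of $\sum_j p\,(1 - (w - z)p)^j = 1/(w - z)$ do the rest. Such a $p$ exists by Runge's pole pushing, because the
complement of $K \cup L$ is connected by Janiszewski's theorem.\<close>

subsection \<open>Polynomial approximation of the Cauchy kernel\<close>

text \<open>Membership in the uniform closure of the polynomials on \<open>X\<close>. The pointwise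
  form keeps suprema out of the closure arguments below.\<close>

definition poly_approximable :: "complex set \<Rightarrow> (complex \<Rightarrow> complex) \<Rightarrow> bool" where
  "poly_approximable X f \<longleftrightarrow> (\<forall>e>0. \<exists>p. \<forall>z\<in>X. cmod (f z - poly p z) < e)"

lemma poly_approximable_poly: "poly_approximable X (poly p)"
  unfolding poly_approximable_def by (metis diff_self norm_zero)

lemma poly_approximable_const: "poly_approximable X (\<lambda>z. c)"
proof -
  have "poly [:c:] = (\<lambda>z. c)" by auto
  then show ?thesis using poly_approximable_poly[of X "[:c:]"] by simp
qed

text \<open>A polynomial within 1 of \<open>f\<close> is bounded on the compact set, hence so is
  \<open>f\<close>. The bounds control the factors of products.\<close>

lemma poly_approximable_bounded:
  assumes "compact X" "poly_approximable X f"
  obtains B where "B > 0" "\<And>z. z \<in> X \<Longrightarrow> cmod (f z) \<le> B"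
proof -
  obtain p where p: "\<And>z. z \<in> X \<Longrightarrow> cmod (f z - poly p z) < 1"
    using assms(2) unfolding poly_approximable_def by (meson zero_less_one)
  have "compact (poly p ` X)"
    using assms(1) by (intro compact_continuous_image continuous_intros)
  then obtain B where B: "B > 0" "\<And>y. y \<in> poly p ` X \<Longrightarrow> cmod y \<le> B"
    using compact_imp_bounded bounded_pos by metis
  have "cmod (f z) \<le> B + 1" if "z \<in> X" for z
    using p[OF that] B(2)[of "poly p z"] that norm_triangle_sub[of "f z" "poly p z"] by force
  then show ?thesis using that[of "B + 1"] \<open>B > 0\<close> by force
qed

lemma poly_approximable_add:
  assumes "poly_approximable X f" "poly_approximable X g"
  shows "poly_approximable X (\<lambda>z. f z + g z)"
  unfolding poly_approximable_def
proof (intro allI impI)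
  fix e :: real assume "e > 0"
  then have "e / 2 > 0" by simp
  then obtain p q where p: "\<And>z. z \<in> X \<Longrightarrow> cmod (f z - poly p z) < e / 2"
    and q: "\<And>z. z \<in> X \<Longrightarrow> cmod (g z - poly q z) < e / 2"
    using assms unfolding poly_approximable_def by meson
  have "cmod (f z + g z - poly (p + q) z) < e" if "z \<in> X" for z
    using norm_diff_triangle_ineq[of "f z" "g z" "poly p z" "poly q z"] p[OF that] q[OF that]
    by (simp add: algebra_simps)
  then show "\<exists>p. \<forall>z\<in>X. cmod (f z + g z - poly p z) < e" by blast
qed

text \<open>The identity f g - p q = f (g - q) + (f - p) q reduces the error to bounds for
  \<open>f\<close> and for the approximating factor q.\<close>

lemma poly_approximable_mult:
  assumes X: "compact X" and f: "poly_approximable X f" and g: "poly_approximable X g"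
  shows "poly_approximable X (\<lambda>z. f z * g z)"
  unfolding poly_approximable_def
proof (intro allI impI)
  fix e :: real assume "e > 0"
  obtain A where A: "A > 0" "\<And>z. z \<in> X \<Longrightarrow> cmod (f z) \<le> A"
    using poly_approximable_bounded[OF X f] by metis
  obtain B where B: "B > 0" "\<And>z. z \<in> X \<Longrightarrow> cmod (g z) \<le> B"
    using poly_approximable_bounded[OF X g] by metis
  define S where "S = A + B + 1"
  have "S > 0" using A(1) B(1) by (simp add: S_def)
  \<comment> \<open>The cap 1 keeps |q| \<le> B + 1; the total error is then at most d * (A + B + 1)
    = d * S \<le> e / 2.\<close>
  define d where "d = min 1 (e / (2 * S))"
  have d: "d > 0" "d \<le> 1" "d * S < e"
  proof -
    show "d > 0" "d \<le> 1" using \<open>S > 0\<close> \<open>e > 0\<close> by (auto simp: d_def)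
    have "d * S \<le> e / (2 * S) * S"
      using \<open>S > 0\<close> by (intro mult_right_mono) (auto simp: d_def)
    also have "\<dots> = e / 2" using \<open>S > 0\<close> by simp
    also have "\<dots> < e" using \<open>e > 0\<close> by simp
    finally show "d * S < e" .
  qed
  obtain p q where p: "\<And>z. z \<in> X \<Longrightarrow> cmod (f z - poly p z) < d"
    and q: "\<And>z. z \<in> X \<Longrightarrow> cmod (g z - poly q z) < d"
    using f g d(1) unfolding poly_approximable_def by meson
  have "cmod (f z * g z - poly (p * q) z) < e" if z: "z \<in> X" for z
  proof -
    have "cmod (poly q z) \<le> B + 1"
      using q[OF z] B(2)[OF z] d(2) norm_triangle_sub[of "poly q z" "g z"]
      by (simp add: norm_minus_commute)
    then have "cmod (f z * (g z - poly q z)) + cmod ((f z - poly p z) * poly q z)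
        \<le> A * d + d * (B + 1)"
      unfolding norm_mult using p[OF z] q[OF z] A B d(1) z
      by (intro add_mono mult_mono) (auto intro: less_imp_le)
    also have "\<dots> = d * S" by (simp add: S_def algebra_simps)
    also note \<open>d * S < e\<close>
    finally have "cmod (f z * (g z - poly q z)) + cmod ((f z - poly p z) * poly q z) < e" .
    moreover have "f z * g z - poly (p * q) z = f z * (g z - poly q z) + (f z - poly p z) * poly q z"
      by (simp add: algebra_simps)
    ultimately show ?thesis
      using norm_triangle_ineq[of "f z * (g z - poly q z)" "(f z - poly p z) * poly q z"] by simp
  qed
  then show "\<exists>p. \<forall>z\<in>X. cmod (f z * g z - poly p z) < e" by blast
qed

text \<open>Horner's recursion builds the sum from constants, \<open>u\<close>, sums and
  products.\<close>

lemma poly_approximable_geometric_sum: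
  assumes X: "compact X" and u: "poly_approximable X u"
  shows "poly_approximable X (\<lambda>z. \<Sum>j<n. u z ^ j)"
proof (induction n)
  case 0
  then show ?case using poly_approximable_const[of X 0] by simp
next
  case (Suc n)
  have "poly_approximable X (\<lambda>z. 1 + u z * (\<Sum>j<n. u z ^ j))"
    by (intro poly_approximable_add poly_approximable_mult poly_approximable_const X u Suc)
  moreover have "(\<Sum>j<Suc n. u z ^ j) = 1 + u z * (\<Sum>j<n. u z ^ j)" for z
    by (simp add: sum.lessThan_Suc_shift sum_distrib_left del: sum.lessThan_Suc)
  ultimately show ?case by simp
qed

text \<open>Neumann series: truncating the geometric series of 1 / (1 - u) leaves u^n / (1 - u), of
  modulus at most c^n / (1 - c).\<close>

lemma poly_approximable_inverse_one_minus:
  assumes X: "compact X" and u: "poly_approximable X u"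
    and c: "c < 1" "\<And>z. z \<in> X \<Longrightarrow> cmod (u z) \<le> c"
  shows "poly_approximable X (\<lambda>z. 1 / (1 - u z))"
proof (cases "X = {}")
  case True
  then show ?thesis by (simp add: poly_approximable_def)
next
  case False
  then have "c \<ge> 0" using c(2) norm_ge_zero order.trans by blast
  show ?thesis
    unfolding poly_approximable_def
  proof (intro allI impI)
    fix e :: real assume "e > 0"
    have "(\<lambda>n. c ^ n / (1 - c)) \<longlonglongrightarrow> 0 / (1 - c)"
      using \<open>c \<ge> 0\<close> c(1) by (intro tendsto_intros LIMSEQ_power_zero) auto
    then have "\<forall>\<^sub>F n in sequentially. c ^ n / (1 - c) < e / 2"
      using \<open>e > 0\<close> by (intro order_tendstoD(2)) auto
    then obtain n where n: "c ^ n / (1 - c) < e / 2"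
      by (auto simp: eventually_sequentially)
    have "e / 2 > 0" using \<open>e > 0\<close> by simp
    then obtain p where p: "\<And>z. z \<in> X \<Longrightarrow> cmod ((\<Sum>j<n. u z ^ j) - poly p z) < e / 2"
      using poly_approximable_geometric_sum[OF X u] unfolding poly_approximable_def by meson
    have "cmod (1 / (1 - u z) - poly p z) < e" if z: "z \<in> X" for z
    proof -
      have "u z \<noteq> 1" using c z by force
      then have "1 / (1 - u z) - (\<Sum>j<n. u z ^ j) = u z ^ n / (1 - u z)"
        by (simp add: sum_gp_strict field_simps)
      moreover have "cmod (u z ^ n / (1 - u z)) \<le> c ^ n / (1 - c)"
        unfolding norm_divide norm_power
        using c z \<open>c \<ge> 0\<close> norm_triangle_ineq2[of 1 "u z"]
        by (intro frac_le power_mono) force+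
      ultimately have "cmod (1 / (1 - u z) - (\<Sum>j<n. u z ^ j)) < e / 2"
        using n by (metis order.strict_trans1)
      then show ?thesis
        using p[OF z] norm_diff_triangle_less by fastforce
    qed
    then show "\<exists>p. \<forall>z\<in>X. cmod (1 / (1 - u z) - poly p z) < e" by blast
  qed
qed

text \<open>Pole pushing: for nearby poles $a$, $b$ one has
$\frac{1}{b-z} = \frac{1}{a-z}\cdot\frac{1}{1-(a-b)/(a-z)}$, so approximability is locally constant in the pole, and it holds
for poles far from the origin.\<close>

lemma poly_approximable_cauchy_kernel:
  assumes X: "compact X" and conn: "connected (- X)" and w: "w \<notin> X"
  shows "poly_approximable X (\<lambda>z. 1 / (w - z))"
proof -
  let ?G = "\<lambda>w. poly_approximable X (\<lambda>z. 1 / (w - z))"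
  have push: "?G b" if ab: "a \<notin> X" "b \<notin> X" and c: "c < 1" 
    "\<And>z. z \<in> X \<Longrightarrow> cmod (a - b) \<le> c * cmod (a - z)" and a: "?G a" for a b c
  proof -
    have "poly_approximable X (\<lambda>z. 1 / (1 - (a - b) * (1 / (a - z))))"
    proof (rule poly_approximable_inverse_one_minus[OF X _ c(1)])
      show "poly_approximable X (\<lambda>z. (a - b) * (1 / (a - z)))"
        by (intro poly_approximable_mult poly_approximable_const X a)
      show "cmod ((a - b) * (1 / (a - z))) \<le> c" if "z \<in> X" for z
        using c(2)[OF that] ab that by (simp add: norm_mult norm_divide divide_simps) force
    qed
    then have "poly_approximable X (\<lambda>z. (1 / (a - z)) * (1 / (1 - (a - b) * (1 / (a - z)))))"
      by (intro poly_approximable_mult X a)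
    moreover have "(1 / (a - z)) * (1 / (1 - (a - b) * (1 / (a - z)))) = 1 / (b - z)"
      if "z \<in> X" for z
    proof -
      have "a - z \<noteq> 0" "b - z \<noteq> 0" using ab that by auto
      then show ?thesis by (simp add: divide_simps)
    qed
    ultimately show ?thesis by (simp add: poly_approximable_def)
  qed
  obtain R where R: "R > 0" "\<And>z. z \<in> X \<Longrightarrow> cmod z \<le> R"
    using compact_imp_bounded[OF X] bounded_pos by metis
  \<comment> \<open>On \<open>X\<close> the quotient z / w0 has modulus at most 1/2, so the Neumann
    series applies and provides a starting pole in the complement.\<close>
  define w0 where "w0 = complex_of_real (2 * R)"
  have w0: "cmod w0 = 2 * R" using R by (simp add: w0_def)
  have "w0 \<notin> X" using R w0 by force
  have "?G w0"
  proof -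
    have "poly [:0, 1 / w0:] = (\<lambda>z. z / w0)" by auto
    then have "poly_approximable X (\<lambda>z. z / w0)" by (metis poly_approximable_poly)
    then have "poly_approximable X (\<lambda>z. 1 / (1 - z / w0))"
      by (intro poly_approximable_inverse_one_minus[OF X, of _ "1/2"])
        (use R w0 in \<open>auto simp: norm_divide divide_simps mult.commute\<close>)
    then have "poly_approximable X (\<lambda>z. (1 / w0) * (1 / (1 - z / w0)))"
      by (intro poly_approximable_mult poly_approximable_const X)
    moreover have "(1 / w0) * (1 / (1 - z / w0)) = 1 / (w0 - z)" if "z \<in> X" for z
    proof -
      have "w0 \<noteq> 0" "w0 - z \<noteq> 0" using \<open>w0 \<notin> X\<close> that R by (auto simp: w0_def)
      then show ?thesis by (simp add: divide_simps)
    qed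
    ultimately show ?thesis by (simp add: poly_approximable_def)
  qed
  \<comment> \<open>Agreement of the truth values of \<open>?G\<close> is an equivalence relation
    whose classes are open in \<open>- X\<close>; connectedness leaves a single class.\<close>
  have "?G w0 = ?G w"
  proof (rule connected_equivalence_relation[where R = "\<lambda>a b. ?G a = ?G b", OF conn])
    fix a assume a: "a \<in> - X"
    have "\<exists>d>0. \<forall>z\<in>X. d \<le> dist a z"
      using separate_point_closed[OF compact_imp_closed[OF X]] a by auto
    then obtain d where d: "d > 0" "\<And>z. z \<in> X \<Longrightarrow> d \<le> dist a z" by blast
    \<comment> \<open>Points x of this ball keep distance at least 3 d / 4 from \<open>X\<close>, so
      \<open>push\<close> works with ratio 1/2 from \<open>a\<close> to x and also back.\<close>
    define T where "T = ball a (d / 4)"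
    have TX: "T \<subseteq> - X" using d by (force simp: T_def)
    have "?G a = ?G x" if x: "x \<in> T" for x
    proof -
      have ax: "cmod (a - x) < d / 4" using x by (simp add: T_def dist_norm)
      have *: "d \<le> cmod (a - z)" "3 * d / 4 \<le> cmod (x - z)" if "z \<in> X" for z
        using d(2)[OF that] ax norm_triangle_sub[of "a - z" "x - z"] by (auto simp: dist_norm)
      have "cmod (a - x) \<le> 1/2 * cmod (a - z)" "cmod (x - a) \<le> 1/2 * cmod (x - z)" if "z \<in> X" for z
        using *[OF that] ax norm_ge_zero[of "a - x"] norm_minus_commute[of x a] by linarith+
      then show ?thesis
        using push[of a x "1/2"] push[of x a "1/2"] a x TX by auto
    qed
    moreover have "openin (top_of_set (- X)) T"
      using TX by (intro open_subset) (auto simp: T_def)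
    ultimately show "\<exists>T. openin (top_of_set (- X)) T \<and> a \<in> T \<and> (\<forall>x\<in>T. ?G a = ?G x)"
      using d(1) by (intro exI[of _ T]) (auto simp: T_def)
  qed (use w \<open>w0 \<notin> X\<close> in auto)
  with \<open>?G w0\<close> show ?thesis by simp
qed

section \<open>From one pole to a compact set of poles\<close>

text \<open>Multiplying an approximation of the kernel by the bounded factor w - z gives an
  approximation of 1. The bound 1/4 leaves room to move w and still stay below 1/2.\<close>

lemma approximate_reciprocal:
  assumes X: "compact X" and conn: "connected (- X)" and w: "w \<notin> X"
  shows "\<exists>p. \<forall>z\<in>X. cmod (1 - (w - z) * poly p z) < 1 / 4"
proof -
  obtain R where R: "R > 0" "\<And>z. z \<in> X \<Longrightarrow> cmod (w - z) \<le> R"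
  proof -
    have "compact ((\<lambda>z. w - z) ` X)" using X by (intro compact_continuous_image continuous_intros)
    then obtain R where "R > 0" "\<And>y. y \<in> (\<lambda>z. w - z) ` X \<Longrightarrow> cmod y \<le> R"
      using compact_imp_bounded bounded_pos by metis
    then show ?thesis using that by blast
  qed
  then have "1 / (4 * R) > 0" by simp
  then obtain p where p: "\<And>z. z \<in> X \<Longrightarrow> cmod (1 / (w - z) - poly p z) < 1 / (4 * R)"
    using poly_approximable_cauchy_kernel[OF assms] unfolding poly_approximable_def by meson
  have "cmod (1 - (w - z) * poly p z) < 1 / 4" if z: "z \<in> X" for z
  proof -
    have "w - z \<noteq> 0" using z w by auto
    then have "1 - (w - z) * poly p z = (w - z) * (1 / (w - z) - poly p z)"
      by (simp add: field_simps)
    then have "cmod (1 - (w - z) * poly p z) = cmod (w - z) * cmod (1 / (w - z) - poly p z)"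
      by (simp add: norm_mult)
    also have "\<dots> < R * (1 / (4 * R))"
      using R(2)[OF z] p[OF z] R(1) by (intro mult_le_less_imp_less) (use \<open>w - z \<noteq> 0\<close> in auto)
    finally show ?thesis using R(1) by simp
  qed
  then show ?thesis by blast
qed

text \<open>The bound on $1 - (w - z)p(z)$ is convex in $p$, so polynomials that work near finitely many points
of $\Gamma$ can be glued by a partition of unity; the coefficients then depend continuously on $w$.\<close>

lemma uniform_approximate_reciprocal:
  assumes X: "compact X" and conn: "connected (- X)" and \<Gamma>: "compact \<Gamma>" "\<Gamma> \<inter> X = {}"
  obtains f :: "complex \<Rightarrow> complex poly" and d :: nat where
    "\<And>w. w \<in> \<Gamma> \<Longrightarrow> degree (f w) \<le> d"
    "\<And>k. continuous_on \<Gamma> (\<lambda>w. coeff (f w) k)"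
    "\<And>w z. w \<in> \<Gamma> \<Longrightarrow> z \<in> X \<Longrightarrow> cmod (1 - (w - z) * poly (f w) z) \<le> 1 / 2"
proof -
  have "\<exists>p \<delta>. \<delta> > 0 \<and> (\<forall>z\<in>X. \<forall>w'\<in>ball w \<delta>. cmod (1 - (w' - z) * poly p z) \<le> 1 / 2)" if w: "w \<in> \<Gamma>" for w
  proof -
    obtain p where p: "\<And>z. z \<in> X \<Longrightarrow> cmod (1 - (w - z) * poly p z) < 1 / 4"
      using approximate_reciprocal[OF X conn, of w] \<Gamma> w by blast
    obtain B where B: "B > 0" "\<And>z. z \<in> X \<Longrightarrow> cmod (poly p z) \<le> B"
      using poly_approximable_bounded[OF X poly_approximable_poly] by metis
    \<comment> \<open>Moving w by less than 1 / (4 * B) changes the value by at most 1/4, the slack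
      between 1/4 and 1/2.\<close>
    have "cmod (1 - (w' - z) * poly p z) \<le> 1 / 2" if "z \<in> X" "w' \<in> ball w (1 / (4 * B))" for z w'
    proof -
      have "cmod ((w - w') * poly p z) \<le> 1 / (4 * B) * B"
        unfolding norm_mult using B that by (intro mult_mono) (auto simp: dist_norm)
      also have "\<dots> = 1 / 4" using B by simp
      finally have "cmod ((w - w') * poly p z) \<le> 1 / 4" .
      moreover have "1 - (w' - z) * poly p z = (1 - (w - z) * poly p z) + (w - w') * poly p z"
        by (simp add: algebra_simps)
      then have "cmod (1 - (w' - z) * poly p z)
          \<le> cmod (1 - (w - z) * poly p z) + cmod ((w - w') * poly p z)"
        by (metis norm_triangle_ineq)
      ultimately show ?thesis using p[OF that(1)] by linarith
    qed
    then show ?thesis using B(1) by (intro exI[of _ p] exI[of _ "1 / (4 * B)"]) auto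
  qed
  then obtain p \<delta> where \<delta>: "\<And>w. w \<in> \<Gamma> \<Longrightarrow> \<delta> w > (0::real)"
    and p: "\<And>w z w'. w \<in> \<Gamma> \<Longrightarrow> z \<in> X \<Longrightarrow> w' \<in> ball w (\<delta> w) \<Longrightarrow> cmod (1 - (w' - z) * poly (p w) z) \<le> 1 / 2"
    by metis
  have cover: "\<Gamma> \<subseteq> (\<Union>w\<in>\<Gamma>. ball w (\<delta> w))"
    using \<delta> by auto
  obtain W where W: "W \<subseteq> \<Gamma>" "finite W" "\<Gamma> \<subseteq> (\<Union>w\<in>W. ball w (\<delta> w))"
    using compactE_image[OF \<Gamma>(1) open_ball cover] by blast
  \<comment> \<open>Tent functions supported in the covering balls. Divided by their sum
    \<open>H\<close>, which is positive on \<Gamma>, they form a partition of unity.\<close>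
  define h where "h v w = max 0 (\<delta> v - dist v w)" for v w
  define H where "H w = (\<Sum>v\<in>W. h v w)" for w
  have h: "h v w \<ge> 0" "v \<in> W \<Longrightarrow> h v w \<noteq> 0 \<Longrightarrow> w \<in> ball v (\<delta> v)" for v w
    by (auto simp: h_def max_def split: if_splits)
  have H: "H w > 0" if w: "w \<in> \<Gamma>" for w
  proof -
    obtain v where v: "v \<in> W" "w \<in> ball v (\<delta> v)" using W(3) w by blast
    then have "h v w > 0" by (auto simp: h_def)
    then show ?thesis unfolding H_def using v W(2) h(1) by (intro sum_pos2)
  qed
  have h_cont: "continuous_on A (h v)" for A v
    unfolding h_def by (intro continuous_intros)
  then have H_cont: "continuous_on A H" for A
    unfolding H_def by (intro continuous_intros)
  define f where "f w = (\<Sum>v\<in>W. smult (of_real (h v w / H w)) (p v))" for w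
  show ?thesis
  \<comment> \<open>The inserted 0 gives \<open>Max\<close> a meaning when \<open>W\<close> is
    empty.\<close>
  proof (rule that[of f "Max (insert 0 (degree ` p ` W))"])
    show "degree (f w) \<le> Max (insert 0 (degree ` p ` W))" for w
      unfolding f_def using W(2)
      by (intro degree_sum_le) (auto intro: order.trans[OF degree_smult_le] Max_ge)
    show "continuous_on \<Gamma> (\<lambda>w. coeff (f w) k)" for k
    proof -
      have "continuous_on \<Gamma> (\<lambda>w. \<Sum>v\<in>W. of_real (h v w / H w) * coeff (p v) k)"
        using H by (intro continuous_intros h_cont H_cont) force
      then show ?thesis by (simp add: f_def coeff_sum)
    qed
    fix w z assume w: "w \<in> \<Gamma>" and z: "z \<in> X"
    have S: "(\<Sum>v\<in>W. h v w / H w) = 1"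
      using H[OF w] by (simp add: H_def flip: sum_divide_distrib)
    then have S': "(\<Sum>v\<in>W. complex_of_real (h v w / H w)) = 1"
      by (metis of_real_1 of_real_sum)
    \<comment> \<open>The weights sum to 1, so the error of \<open>f w\<close> is the convex
      combination of the errors of the \<open>p v\<close>, and only those v whose ball contains w
      contribute.\<close>
    have "1 - (w - z) * poly (f w) z =
        (\<Sum>v\<in>W. of_real (h v w / H w)) - (w - z) * (\<Sum>v\<in>W. of_real (h v w / H w) * poly (p v) z)"
      unfolding S' by (simp add: f_def poly_sum)
    also have "\<dots> = (\<Sum>v\<in>W. of_real (h v w / H w) * (1 - (w - z) * poly (p v) z))"
      unfolding sum_distrib_left sum_subtractf[symmetric]
      by (intro sum.cong refl) (simp only: right_diff_distrib mult_1_right mult.left_commute)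
    also have "cmod \<dots> \<le> (\<Sum>v\<in>W. h v w / H w * (1 / 2))"
    proof (rule sum_norm_le)
      fix v assume v: "v \<in> W"
      show "cmod (of_real (h v w / H w) * (1 - (w - z) * poly (p v) z)) \<le> h v w / H w * (1 / 2)"
      proof (cases "h v w = 0")
        case False
        then have "cmod (1 - (w - z) * poly (p v) z) \<le> 1 / 2"
          using p[of v z w] v W(1) z h(2) by blast
        then show ?thesis
          unfolding norm_mult norm_of_real using h(1)[of v w] H[OF w] by (intro mult_mono) auto
      qed simp
    qed
    also have "\<dots> = 1 / 2" unfolding sum_distrib_right[symmetric] S by simp
    finally show "cmod (1 - (w - z) * poly (f w) z) \<le> 1 / 2" .
  qed
qed

section \<open>Geometric rate for the Cauchy kernel\<close>

lemma continuous_on_coeff_mult: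
  assumes "\<And>k. continuous_on A (\<lambda>w. coeff (f w) k)" "\<And>k. continuous_on A (\<lambda>w. coeff (g w) k)"
  shows "continuous_on A (\<lambda>w. coeff (f w * g w :: complex poly) k)"
  unfolding coeff_mult by (intro continuous_intros assms)

lemma continuous_on_coeff_power:
  assumes "\<And>k. continuous_on A (\<lambda>w. coeff (f w) k)"
  shows "continuous_on A (\<lambda>w. coeff (f w ^ j :: complex poly) k)"
  by (induction j arbitrary: k) (auto intro!: continuous_on_coeff_mult assms)

text \<open>With e = 1 - (w - z) p of modulus at most 1/2, p times the sum of e^j over j < J differs
  from 1 / (w - z) by e^J / (w - z). Each further term costs a fixed number of degrees and halves
  the bound, hence a geometric rate in the degree. Continuity of the coefficients in w allows
  integration over \<Gamma> later.\<close>

lemma cauchy_kernel_geometric_approximation: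
  assumes X: "compact X" and conn: "connected (- X)" and \<Gamma>: "compact \<Gamma>" "\<Gamma> \<inter> X = {}"
  obtains C \<theta> :: real and g :: "nat \<Rightarrow> complex \<Rightarrow> complex poly" where
    "C > 0" "0 < \<theta>" "\<theta> < 1"
    "\<And>n w. w \<in> \<Gamma> \<Longrightarrow> degree (g n w) \<le> n"
    "\<And>n k. continuous_on \<Gamma> (\<lambda>w. coeff (g n w) k)"
    "\<And>n w z. w \<in> \<Gamma> \<Longrightarrow> z \<in> X \<Longrightarrow> cmod (1 / (w - z) - poly (g n w) z) \<le> C * \<theta> ^ n"
proof -
  obtain f d where deg: "\<And>w. w \<in> \<Gamma> \<Longrightarrow> degree (f w) \<le> d"
    and cont: "\<And>k. continuous_on \<Gamma> (\<lambda>w. coeff (f w) k)"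
    and f: "\<And>w z. w \<in> \<Gamma> \<Longrightarrow> z \<in> X \<Longrightarrow> cmod (1 - (w - z) * poly (f w) z) \<le> 1 / 2"
    using uniform_approximate_reciprocal[OF assms] by metis
  obtain s where s: "s > 0" "\<And>w z. w \<in> \<Gamma> \<Longrightarrow> z \<in> X \<Longrightarrow> s \<le> dist w z"
    using separate_compact_closed[OF \<Gamma>(1) compact_imp_closed[OF X] \<Gamma>(2)] by auto
  \<comment> \<open>\<open>[:w, -1:]\<close> is w - z as a polynomial in z, so \<open>e w\<close>
    has degree at most d + 1.\<close>
  define e where "e w = 1 - [:w, -1:] * f w" for w
  \<comment> \<open>With J = n div (d + 1) > 0 terms the degree is at most d + (d + 1) * (J - 1) <
    n; with J = 0 this is the zero polynomial.\<close>
  define g where "g n w = f w * (\<Sum>j<n div (d + 1). e w ^ j)" for n w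
  \<comment> \<open>One factor 1/2 for every d + 1 degrees.\<close>
  define \<theta> where "\<theta> = root (d + 1) (1 / 2)"
  have \<theta>: "0 < \<theta>" "\<theta> < 1" "\<theta> ^ (d + 1) = 1 / 2"
    by (auto simp: \<theta>_def simp del: power_Suc)
  show ?thesis
  proof (rule that[of "2 / s" \<theta> g])
    show "2 / s > 0" "0 < \<theta>" "\<theta> < 1" using s \<theta> by auto
    have "\<And>w. w \<in> \<Gamma> \<Longrightarrow> degree (e w) \<le> d + 1"
      unfolding e_def using deg
      by (intro degree_diff_le order.trans[OF degree_mult_le]) (auto intro: le_SucI)
    then have "degree (e w ^ j) \<le> (d + 1) * j" if "w \<in> \<Gamma>" for w j
      using that by (meson degree_power_le mult_le_mono1 order.trans)
    then show "degree (g n w) \<le> n" if w: "w \<in> \<Gamma>" for n w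
    proof (cases "n div (d + 1)")
      case 0
      then show ?thesis unfolding g_def by simp
    next
      case (Suc J)
      have "degree (\<Sum>j<Suc J. e w ^ j) \<le> (d + 1) * J"
      proof (rule degree_sum_le)
        fix j assume "j \<in> {..<Suc J}"
        then have "(d + 1) * j \<le> (d + 1) * J" by (intro mult_le_mono2) auto
        then show "degree (e w ^ j) \<le> (d + 1) * J"
          using \<open>\<And>w j. w \<in> \<Gamma> \<Longrightarrow> degree (e w ^ j) \<le> (d + 1) * j\<close>[OF w, of j] by linarith
      qed simp
      then have "degree (g n w) \<le> d + (d + 1) * J"
        unfolding g_def Suc by (intro order.trans[OF degree_mult_le] add_mono deg[OF w])
      also have "\<dots> \<le> (d + 1) * (n div (d + 1))" unfolding Suc by simp
      also have "\<dots> \<le> n" by (rule times_div_less_eq_dividend)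
      finally show ?thesis .
    qed
    have "continuous_on \<Gamma> (\<lambda>w. coeff (e w) k)" for k
    proof -
      have "continuous_on \<Gamma> (\<lambda>w. coeff [:w, -1:] k)" for k
        by (cases k) (auto simp: coeff_pCons split: nat.split intro!: continuous_intros)
      then show ?thesis
        unfolding e_def coeff_diff by (intro continuous_intros continuous_on_coeff_mult cont)
    qed
    then show "continuous_on \<Gamma> (\<lambda>w. coeff (g n w) k)" for n k
      unfolding g_def
      by (intro continuous_on_coeff_mult cont)
        (auto simp: coeff_sum intro!: continuous_intros continuous_on_coeff_power)
    show "cmod (1 / (w - z) - poly (g n w) z) \<le> 2 / s * \<theta> ^ n" if wz: "w \<in> \<Gamma>" "z \<in> X" for n w z
    proof -
      define u where "u = 1 - (w - z) * poly (f w) z"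
      have nz: "w - z \<noteq> 0" using wz \<Gamma> by auto
      have u: "cmod u \<le> 1 / 2" using f[OF wz] by (simp add: u_def)
      then have "u \<noteq> 1" by auto
      have pf: "poly (f w) z = (1 - u) / (w - z)" using nz by (simp add: u_def)
      have pe: "poly (e w) z = u" by (simp add: e_def u_def algebra_simps)
      have "poly (g n w) z = (1 - u) / (w - z) * (\<Sum>j<n div (d + 1). u ^ j)"
        by (simp add: g_def poly_sum pf pe)
      also have "\<dots> = (1 - u ^ (n div (d + 1))) / (w - z)"
        using \<open>u \<noteq> 1\<close> nz by (simp add: sum_gp_strict)
      finally have "1 / (w - z) - poly (g n w) z = u ^ (n div (d + 1)) / (w - z)"
        by (simp add: diff_divide_distrib)
      then have "cmod (1 / (w - z) - poly (g n w) z) = cmod u ^ (n div (d + 1)) / cmod (w - z)"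
        by (simp add: norm_divide norm_power)
      also have "\<dots> \<le> (1 / 2) ^ (n div (d + 1)) / s"
        using u s(1) s(2)[OF wz] by (intro frac_le power_mono) (auto simp: dist_norm)
      \<comment> \<open>Rounding in \<open>n div (d + 1)\<close> loses at most one factor 1/2, which
        the 2 in the constant 2 / s pays for.\<close>
      also have "(1 / 2) ^ (n div (d + 1)) \<le> 2 * \<theta> ^ n"
      proof -
        have "(1 / 2) ^ (n div (d + 1)) * (1 / 2) = \<theta> ^ ((d + 1) * (n div (d + 1)) + (d + 1))"
          unfolding power_add[of \<theta> "(d + 1) * (n div (d + 1))"] power_mult[of \<theta> "d + 1"] \<theta>(3) ..
        also have "\<dots> \<le> \<theta> ^ n"
        proof (rule power_decreasing)
          show "n \<le> (d + 1) * (n div (d + 1)) + (d + 1)"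
            using mult_div_mod_eq[of "d + 1" n] mod_less_divisor[of "d + 1" n] by linarith
        qed (use \<theta> in auto)
        finally show ?thesis by simp
      qed
      finally show ?thesis using s(1) by (simp add: divide_right_mono)
    qed
  qed
qed

subsection \<open>Cauchy cycles around compact sets\<close>

text \<open>Terms with index in both \<open>S\<close> and its shift cancel; the symmetric difference
  survives with signs. For a set \<open>S\<close> of cells and edge integrals \<open>h\<close>, this
  removes the edges between two cells of \<open>S\<close>.\<close>

lemma sum_diff_shift:
  fixes h :: "'a \<Rightarrow> 'b::ab_group_add"
  assumes "finite S" "inj s"
  shows "(\<Sum>x\<in>S. h x - h (s x)) =
    (\<Sum>x\<in>(S - s ` S) \<union> (s ` S - S). if x \<in> S then h x else - h x)"
proof -
  have "(\<Sum>x\<in>S. h x - h (s x)) = sum h S - sum h (s ` S)"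
    using assms(2) by (simp add: sum_subtractf sum.reindex inj_def inj_on_def)
  also have "\<dots> = sum h (S - s ` S) - sum h (s ` S - S)"
    using assms(1) sum.Int_Diff[of S h "s ` S"] sum.Int_Diff[of "s ` S" h S] by (simp add: Int_commute)
  also have "\<dots> = (\<Sum>x\<in>S - s ` S. if x \<in> S then h x else - h x) +
      (\<Sum>x\<in>s ` S - S. if x \<in> S then h x else - h x)"
    by (simp add: sum_negf)
  also have "\<dots> = (\<Sum>x\<in>(S - s ` S) \<union> (s ` S - S). if x \<in> S then h x else - h x)"
    using assms(1) by (intro sum.union_disjoint[symmetric]) auto
  finally show ?thesis .
qed

section \<open>Square grids and the Cauchy formula on one cell\<close>

definition grid_point :: "real \<Rightarrow> int \<Rightarrow> int \<Rightarrow> complex" where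
  "grid_point \<delta> i j = Complex (\<delta> * of_int i) (\<delta> * of_int j)"

definition grid_cell :: "real \<Rightarrow> int \<Rightarrow> int \<Rightarrow> complex set" where
  "grid_cell \<delta> i j = cbox (grid_point \<delta> i j) (grid_point \<delta> (i + 1) (j + 1))"

lemma Re_grid_point [simp]: "Re (grid_point \<delta> i j) = \<delta> * of_int i"
  and Im_grid_point [simp]: "Im (grid_point \<delta> i j) = \<delta> * of_int j"
  by (simp_all add: grid_point_def)

text \<open>The top and left sides are reversed, so that every side points right or up. A side
  shared by two neighbouring cells is then the same segment with opposite signs.\<close>

lemma contour_integral_rectpath:
  assumes "continuous_on (path_image (rectpath a c)) g" "Re a \<le> Re c" "Im a \<le> Im c"
  shows "contour_integral (rectpath a c) g =
     contour_integral (linepath a (Complex (Re c) (Im a))) g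
   + contour_integral (linepath (Complex (Re c) (Im a)) c) g
   - contour_integral (linepath (Complex (Re a) (Im c)) c) g
   - contour_integral (linepath a (Complex (Re a) (Im c))) g"
proof -
  let ?b = "Complex (Re c) (Im a)" and ?d = "Complex (Re a) (Im c)"
  have im: "path_image (rectpath a c) =
      closed_segment a ?b \<union> closed_segment ?b c \<union> closed_segment c ?d \<union> closed_segment ?d a"
    by (simp add: rectpath_def Let_def path_image_join Un_assoc)
  have cont: "continuous_on (closed_segment a ?b) g" "continuous_on (closed_segment ?b c) g"
    "continuous_on (closed_segment c ?d) g" "continuous_on (closed_segment ?d a) g"
    by (rule continuous_on_subset[OF assms(1)[unfolded im]]; blast)+
  have "contour_integral (rectpath a c) g = contour_integral (linepath a ?b) g
      + (contour_integral (linepath ?b c) g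
      + (contour_integral (linepath c ?d) g + contour_integral (linepath ?d a) g))"
    unfolding rectpath_def Let_def
    by (simp add: contour_integral_join valid_path_join contour_integrable_joinI
        contour_integrable_continuous_linepath cont)
  then show ?thesis
    using contour_integral_reverse_linepath[OF cont(3)] contour_integral_reverse_linepath[OF cont(4)]
    by simp
qed

text \<open>Cauchy's formula with winding number 1 for z inside, Cauchy's theorem for z outside. The
  hypothesis on z keeps the singularity off the path.\<close>

lemma contour_integral_grid_cell:
  assumes \<delta>: "\<delta> > 0" and f: "f holomorphic_on grid_cell \<delta> i j"
    and z: "z \<notin> grid_cell \<delta> i j \<or> z \<in> box (grid_point \<delta> i j) (grid_point \<delta> (i + 1) (j + 1))"
  defines "g \<equiv> \<lambda>w. f w / (w - z)"
  shows "contour_integral (linepath (grid_point \<delta> i j) (grid_point \<delta> (i + 1) j)) g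
       + contour_integral (linepath (grid_point \<delta> (i + 1) j) (grid_point \<delta> (i + 1) (j + 1))) g
       - contour_integral (linepath (grid_point \<delta> i (j + 1)) (grid_point \<delta> (i + 1) (j + 1))) g
       - contour_integral (linepath (grid_point \<delta> i j) (grid_point \<delta> i (j + 1))) g
     = (if z \<in> grid_cell \<delta> i j then 2 * of_real pi * \<i> * f z else 0)"
proof -
  let ?a = "grid_point \<delta> i j" and ?c = "grid_point \<delta> (i + 1) (j + 1)"
  have le: "Re ?a \<le> Re ?c" "Im ?a \<le> Im ?c" using \<delta> by (auto simp: algebra_simps)
  have sub: "path_image (rectpath ?a ?c) \<subseteq> grid_cell \<delta> i j - {z}"
    using z path_image_rectpath_cbox_minus_box[OF le] by (auto simp: grid_cell_def)
  have "continuous_on (path_image (rectpath ?a ?c)) g"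
    unfolding g_def using sub f
    by (intro continuous_intros continuous_on_subset[OF holomorphic_on_imp_continuous_on[OF f]]) auto
  note rect = contour_integral_rectpath[OF this le]
  have corners: "Complex (Re ?c) (Im ?a) = grid_point \<delta> (i + 1) j"
    "Complex (Re ?a) (Im ?c) = grid_point \<delta> i (j + 1)"
    by (simp_all add: grid_point_def)
  have "contour_integral (rectpath ?a ?c) g = (if z \<in> grid_cell \<delta> i j then 2 * of_real pi * \<i> * f z else 0)"
  proof (cases "z \<in> grid_cell \<delta> i j")
    case True
    with z have box: "z \<in> box ?a ?c" by simp
    then have int: "z \<in> interior (grid_cell \<delta> i j)" by (simp add: grid_cell_def)
    have "(g has_contour_integral (of_real (2 * pi) * \<i> * winding_number (rectpath ?a ?c) z * f z))
        (rectpath ?a ?c)"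
      unfolding g_def
      by (rule Cauchy_integral_formula_convex_simple[OF _ f int _ sub]) (auto simp: grid_cell_def)
    then show ?thesis
      using True by (simp add: contour_integral_unique winding_number_rectpath[OF box])
  next
    case False
    have "(g has_contour_integral 0) (rectpath ?a ?c)"
    proof (rule Cauchy_theorem_convex_simple)
      show "g holomorphic_on grid_cell \<delta> i j"
        unfolding g_def using False by (intro holomorphic_intros f) auto
    qed (use sub in \<open>auto simp: grid_cell_def\<close>)
    then show ?thesis using False by (simp add: contour_integral_unique)
  qed
  then show ?thesis using rect by (simp only: corners)
qed

text \<open>Differentiation under the integral sign. The continuity carries the Cauchy formula from
  interior points of cells to points on grid lines.\<close>

lemma isCont_contour_integral_linepath_kernel:
  assumes f: "continuous_on (closed_segment a b) f" and z: "z \<notin> closed_segment a b"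
  shows "isCont (\<lambda>z. contour_integral (linepath a b) (\<lambda>w. f w / (w - z))) z"
proof -
  have int: "((\<lambda>w. f w / (w - z) ^ 1) has_contour_integral
      contour_integral (linepath a b) (\<lambda>w. f w / (w - z))) (linepath a b)"
    if "z \<in> UNIV - path_image (linepath a b)" for z
  proof -
    have "continuous_on (closed_segment a b) (\<lambda>w. f w / (w - z))"
      using that by (intro continuous_intros f) auto
    then show ?thesis
      by (simp add: contour_integrable_continuous_linepath has_contour_integral_integral)
  qed
  have "((\<lambda>z. contour_integral (linepath a b) (\<lambda>w. f w / (w - z))) has_field_derivative
      (of_nat 1 * contour_integral (linepath a b) (\<lambda>w. f w / (w - z) ^ Suc 1))) (at z)"
    \<comment> \<open>\<open>B\<close> is the constant speed of the segment.\<close>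
    by (rule Cauchy_next_derivative(2)[where S = UNIV and B = "cmod (b - a)", OF _ _ int])
      (use f z in auto)
  then show ?thesis by (rule DERIV_isCont)
qed

text \<open>The cycle is the boundary of the union of the cells of a fine square grid that meet $K$: an edge
shared by two such cells cancels, and an edge meeting $K$ is always shared. The index \<open>(True, i, j)\<close> stands for the horizontal
edge starting at the grid point $(i, j)$ and \<open>(False, i, j)\<close> for the vertical one. Points of $K$ on grid lines are reached as
limits of points inside a cell.\<close>

lemma cauchy_cycle_exists:
  fixes K V :: "complex set"
  assumes K: "compact K" and V: "open V" and KV: "K \<subseteq> V"
  obtains I :: "(bool \<times> int \<times> int) set" and a b c :: "bool \<times> int \<times> int \<Rightarrow> complex" where
    "finite I" "\<And>x. x \<in> I \<Longrightarrow> closed_segment (a x) (b x) \<subseteq> V - K"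
    "\<And>f z. f holomorphic_on V \<Longrightarrow> z \<in> K \<Longrightarrow>
       (\<Sum>x\<in>I. c x * contour_integral (linepath (a x) (b x)) (\<lambda>w. f w / (w - z))) = f z"
    "\<And>f z. f holomorphic_on V \<Longrightarrow> z \<notin> V \<Longrightarrow>
       (\<Sum>x\<in>I. c x * contour_integral (linepath (a x) (b x)) (\<lambda>w. f w / (w - z))) = 0"
proof -
  obtain d where d: "d > 0" "\<And>x y. x \<in> K \<Longrightarrow> y \<notin> V \<Longrightarrow> d \<le> dist x y"
    using separate_compact_closed[OF K closed_Compl[OF V]] KV by blast
  \<comment> \<open>Two points of one cell are at distance at most 2 * \<delta> < d, so a cell that
    meets \<open>K\<close> lies in \<open>V\<close>.\<close>
  define \<delta> where "\<delta> = d / 3"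
  have \<delta>: "\<delta> > 0" using d by (simp add: \<delta>_def)
  define S where "S = {(i, j). grid_cell \<delta> i j \<inter> K \<noteq> {}}"
  have cell_iff: "z \<in> grid_cell \<delta> i j \<longleftrightarrow>
      \<delta> * of_int i \<le> Re z \<and> Re z \<le> \<delta> * (of_int i + 1) \<and> \<delta> * of_int j \<le> Im z \<and> Im z \<le> \<delta> * (of_int j + 1)"
    for z i j by (simp add: grid_cell_def in_cbox_complex_iff conj_commute)
  have cell_V: "grid_cell \<delta> i j \<subseteq> V" if ij: "(i, j) \<in> S" for i j
  proof
    fix y assume y: "y \<in> grid_cell \<delta> i j"
    obtain x where x: "x \<in> K" "x \<in> grid_cell \<delta> i j" using ij by (auto simp: S_def)
    have "\<bar>Re (x - y)\<bar> \<le> \<delta>" "\<bar>Im (x - y)\<bar> \<le> \<delta>"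
      using x y by (auto simp: cell_iff algebra_simps)
    then have "dist x y < d"
      using cmod_le[of "x - y"] d(1) by (simp add: dist_norm \<delta>_def)
    then show "y \<in> V" using d(2)[OF x(1)] by force
  qed
  have "finite S"
  proof -
    obtain R where R: "\<And>z. z \<in> K \<Longrightarrow> cmod z \<le> R"
      using compact_imp_bounded[OF K] bounded_iff by metis
    \<comment> \<open>The extra 1 is for a cell whose lower corner lies up to one step beyond
      -R.\<close>
    define m where "m = \<lceil>R / \<delta>\<rceil> + 1"
    have m: "i \<in> {-m..m}" if "\<delta> * of_int i \<le> t" "t \<le> \<delta> * (of_int i + 1)" "\<bar>t\<bar> \<le> R" for i t
    proof -
      have "of_int i \<le> R / \<delta>" "- (R / \<delta>) \<le> of_int i + 1"
        using that \<delta> by (auto simp: field_simps)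
      then show ?thesis unfolding m_def by (simp; linarith)
    qed
    have "S \<subseteq> {-m..m} \<times> {-m..m}"
    proof clarify
      fix i j assume "(i, j) \<in> S"
      then obtain z where z: "z \<in> K" "z \<in> grid_cell \<delta> i j" by (auto simp: S_def)
      have "\<bar>Re z\<bar> \<le> R" "\<bar>Im z\<bar> \<le> R"
        using R[OF z(1)] abs_Re_le_cmod[of z] abs_Im_le_cmod[of z] by linarith+
      then show "i \<in> {-m..m} \<and> j \<in> {-m..m}" using z(2) m[of i "Re z"] m[of j "Im z"] by (simp add: cell_iff)
    qed
    then show ?thesis by (rule finite_subset) simp
  qed
  define up right :: "int \<times> int \<Rightarrow> int \<times> int"
    where "up = (\<lambda>(i, j). (i, j + 1))" and "right = (\<lambda>(i, j). (i + 1, j))"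
  have inj: "inj up" "inj right" by (auto simp: up_def right_def inj_def)
  define a b :: "bool \<times> int \<times> int \<Rightarrow> complex"
    where "a = (\<lambda>(h, i, j). grid_point \<delta> i j)"
      and "b = (\<lambda>(h, i, j). if h then grid_point \<delta> (i + 1) j else grid_point \<delta> i (j + 1))"
  \<comment> \<open>The edge with index (i, j) also bounds the cell one step below (horizontal) or
    to the left (vertical). Hence \<open>D h\<close> selects the edges with exactly one adjacent
    cell in \<open>S\<close>.\<close>
  define D where "D h = (let s = if h then up else right in (S - s ` S) \<union> (s ` S - S))" for h
  \<comment> \<open>Counterclockwise orientation: bottom and right sides count positively, top and
    left sides negatively. An index in \<open>S\<close> marks a bottom or left side of the selected
    cell. The Cauchy factor is included.\<close>
  define c where "c = (\<lambda>(h, x). (if h then 1 else -1) * (if x \<in> S then 1 else -1) / (2 * of_real pi * \<i>))"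
  define I where "I = Sigma UNIV D"
  have "finite (D h)" for h using \<open>finite S\<close> by (simp add: D_def Let_def)
  then have "finite I" unfolding I_def by (intro finite_SigmaI) auto

  have edge: "closed_segment (a (h, i, j)) (b (h, i, j)) \<subseteq>
      grid_cell \<delta> i j \<inter> (if h then grid_cell \<delta> i (j - 1) else grid_cell \<delta> (i - 1) j)" for h i j
  proof -
    have "convex (grid_cell \<delta> i j \<inter> (if h then grid_cell \<delta> i (j - 1) else grid_cell \<delta> (i - 1) j))"
      by (auto simp: grid_cell_def intro!: convex_Int)
    then show ?thesis
      using \<delta> by (intro closed_segment_subset) (auto simp: a_def b_def cell_iff algebra_simps)
  qed
  have edge_sub: "closed_segment (a x) (b x) \<subseteq> V - K" if x: "x \<in> I" for x
  proof -
    obtain h i j where hij: "x = (h, i, j)" by (cases x)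
    \<comment> \<open>\<open>p\<close> is the cell across the edge. Exactly one of the two cells is
      in \<open>S\<close>: that one puts the edge in \<open>V\<close>, and the other, which misses
      \<open>K\<close>, keeps it off \<open>K\<close>.\<close>
    define p where "p = (if h then (i, j - 1) else (i - 1, j))"
    have pS: "(i, j) \<in> (if h then up else right) ` S \<longleftrightarrow> p \<in> S"
      by (auto simp: p_def up_def right_def image_iff intro!: bexI[of _ p] split: if_splits)
    then have "((i, j) \<in> S) \<noteq> (p \<in> S)"
      using x by (auto simp: I_def D_def hij Let_def split: if_splits)
    moreover have "closed_segment (a x) (b x) \<subseteq> grid_cell \<delta> i j \<inter> grid_cell \<delta> (fst p) (snd p)"
      using edge[of h i j] by (auto simp: hij p_def)
    ultimately show ?thesis
      using cell_V[of i j] cell_V[of "fst p" "snd p"] unfolding S_def by (cases p) auto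
  qed

  \<comment> \<open>For z on no side of a selected cell, the boundary sum regroups into integrals
    around single cells; \<open>up x\<close> and \<open>right x\<close> index the top and right
    sides of the cell x.\<close>
  have sum_cells: "(\<Sum>x\<in>I. c x * contour_integral (linepath (a x) (b x)) (\<lambda>w. f w / (w - z)))
      = (\<Sum>(i, j)\<in>S. if z \<in> grid_cell \<delta> i j then f z else 0)"
    if f: "f holomorphic_on V" and z: "\<And>i j. (i, j) \<in> S \<Longrightarrow>
      z \<notin> grid_cell \<delta> i j \<or> z \<in> box (grid_point \<delta> i j) (grid_point \<delta> (i + 1) (j + 1))" for f z
  proof -
    define E where "E h x = contour_integral (linepath (a (h, x)) (b (h, x))) (\<lambda>w. f w / (w - z))" for h x
    define k where "k = 2 * of_real pi * \<i>"
    have "k \<noteq> 0" by (simp add: k_def)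
    have "(\<Sum>x\<in>I. c x * contour_integral (linepath (a x) (b x)) (\<lambda>w. f w / (w - z)))
        = (\<Sum>h\<in>UNIV. \<Sum>x\<in>D h. c (h, x) * E h x)"
      unfolding I_def E_def using \<open>\<And>h. finite (D h)\<close> by (subst sum.Sigma) (auto simp: case_prod_unfold)
    also have "\<dots> = ((\<Sum>x\<in>D True. if x \<in> S then E True x else - E True x)
        - (\<Sum>x\<in>D False. if x \<in> S then E False x else - E False x)) / k"
    proof -
      have "(\<Sum>x\<in>D True. c (True, x) * E True x)
          = (\<Sum>x\<in>D True. (if x \<in> S then E True x else - E True x) / k)"
        by (intro sum.cong) (auto simp: c_def k_def)
      moreover have "(\<Sum>x\<in>D False. c (False, x) * E False x)
          = (\<Sum>x\<in>D False. - ((if x \<in> S then E False x else - E False x) / k))"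
        by (intro sum.cong) (auto simp: c_def k_def)
      ultimately show ?thesis
        unfolding UNIV_bool diff_divide_distrib sum_divide_distrib sum_negf by simp
    qed
    also have "\<dots> = ((\<Sum>x\<in>S. E True x - E True (up x)) - (\<Sum>x\<in>S. E False x - E False (right x))) / k"
      unfolding sum_diff_shift[OF \<open>finite S\<close> inj(1)] sum_diff_shift[OF \<open>finite S\<close> inj(2)]
      by (simp add: D_def)
    also have "\<dots> = (\<Sum>x\<in>S. E True x + E False (right x) - E True (up x) - E False x) / k"
      by (simp add: sum_subtractf sum.distrib algebra_simps)
    also have "\<dots> = (\<Sum>(i, j)\<in>S. if z \<in> grid_cell \<delta> i j then k * f z else 0) / k"
    proof (intro arg_cong[where f = "\<lambda>s. s / k"] sum.cong refl, clarify)
      fix i j assume ij: "(i, j) \<in> S"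
      show "E True (i, j) + E False (right (i, j)) - E True (up (i, j)) - E False (i, j)
          = (if z \<in> grid_cell \<delta> i j then k * f z else 0)"
        using contour_integral_grid_cell[OF \<delta> holomorphic_on_subset[OF f cell_V[OF ij]] z[OF ij]]
        by (simp add: E_def a_def b_def up_def right_def k_def)
    qed
    also have "\<dots> = (\<Sum>(i, j)\<in>S. if z \<in> grid_cell \<delta> i j then f z else 0)"
      unfolding sum_divide_distrib using \<open>k \<noteq> 0\<close> by (intro sum.cong) auto
    finally show ?thesis .
  qed

  show ?thesis
  proof (rule that[of I a b c])
    show "finite I" by fact
    show "closed_segment (a x) (b x) \<subseteq> V - K" if "x \<in> I" for x using edge_sub[OF that] .
    show "(\<Sum>x\<in>I. c x * contour_integral (linepath (a x) (b x)) (\<lambda>w. f w / (w - z))) = 0"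
      if f: "f holomorphic_on V" and z: "z \<notin> V" for f z
    proof -
      have "z \<notin> grid_cell \<delta> i j" if "(i, j) \<in> S" for i j using cell_V[OF that] z by blast
      then show ?thesis by (subst sum_cells[OF f]) (auto intro!: sum.neutral)
    qed
    show "(\<Sum>x\<in>I. c x * contour_integral (linepath (a x) (b x)) (\<lambda>w. f w / (w - z))) = f z" (is "?F z = _")
      if f: "f holomorphic_on V" and z: "z \<in> K" for f z
    proof -
      define i0 j0 where "i0 = \<lfloor>Re z / \<delta>\<rfloor>" and "j0 = \<lfloor>Im z / \<delta>\<rfloor>"
      have "of_int i0 \<le> Re z / \<delta>" "Re z / \<delta> < of_int i0 + 1" "of_int j0 \<le> Im z / \<delta>" "Im z / \<delta> < of_int j0 + 1"
        unfolding i0_def j0_def by linarith+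
      then have ij0: "\<delta> * of_int i0 \<le> Re z" "Re z < \<delta> * (of_int i0 + 1)"
        "\<delta> * of_int j0 \<le> Im z" "Im z < \<delta> * (of_int j0 + 1)"
        using \<delta> by (auto simp: field_simps)
      then have "z \<in> grid_cell \<delta> i0 j0" by (simp add: cell_iff)
      then have S0: "(i0, j0) \<in> S" using z by (auto simp: S_def)
      \<comment> \<open>Rounding down puts z in the half-open cell containing its lower and left
        sides, so a small diagonal shift enters the open cell, where no other closed cell
        reaches.\<close>
      define \<zeta> where "\<zeta> t = z + Complex t t" for t
      define r where "r = min (\<delta> * (of_int i0 + 1) - Re z) (\<delta> * (of_int j0 + 1) - Im z)"
      have "r > 0" using ij0 by (simp add: r_def)
      have eq: "?F (\<zeta> t) = f (\<zeta> t)" if t: "0 < t" "t < r" for t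
      proof -
        have box: "\<zeta> t \<in> box (grid_point \<delta> i0 j0) (grid_point \<delta> (i0 + 1) (j0 + 1))"
          using t ij0 by (auto simp: in_box_complex_iff \<zeta>_def r_def)
        have *: "i = i0 \<and> j = j0" if "\<zeta> t \<in> grid_cell \<delta> i j" for i j
        proof -
          have "\<delta> * of_int i < \<delta> * (of_int i0 + 1)" "\<delta> * of_int i0 < \<delta> * (of_int i + 1)"
            "\<delta> * of_int j < \<delta> * (of_int j0 + 1)" "\<delta> * of_int j0 < \<delta> * (of_int j + 1)"
            using box that by (auto simp: in_box_complex_iff cell_iff)
          then show ?thesis using \<delta> by simp
        qed
        have "?F (\<zeta> t) = (\<Sum>(i, j)\<in>S. if \<zeta> t \<in> grid_cell \<delta> i j then f (\<zeta> t) else 0)"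
          using * box by (intro sum_cells[OF f]) blast
        also have "\<dots> = (\<Sum>x\<in>S. if x = (i0, j0) then f (\<zeta> t) else 0)"
        proof -
          have "\<zeta> t \<in> grid_cell \<delta> i0 j0"
            unfolding grid_cell_def using box_subset_cbox box by (rule subsetD)
          with * have "\<zeta> t \<in> grid_cell \<delta> i j \<longleftrightarrow> (i, j) = (i0, j0)" for i j by blast
          then show ?thesis by (intro sum.cong) (auto simp: prod_eq_iff case_prod_unfold)
        qed
        also have "\<dots> = f (\<zeta> t)" using \<open>finite S\<close> S0 by simp
        finally show ?thesis .
      qed
      have \<zeta>: "(\<zeta> \<longlongrightarrow> z) (at_right 0)"
      proof -
        have "((\<lambda>t. z + (of_real t + \<i> * of_real t)) \<longlongrightarrow> z + (of_real 0 + \<i> * of_real 0)) (at_right 0)"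
          by (intro tendsto_intros)
        moreover have "\<zeta> = (\<lambda>t. z + (of_real t + \<i> * of_real t))"
          by (simp add: \<zeta>_def Complex_eq fun_eq_iff)
        ultimately show ?thesis by simp
      qed
      have "isCont f z"
        using f V KV z by (meson continuous_on_eq_continuous_at holomorphic_on_imp_continuous_on subsetD)
      then have lim_f: "((\<lambda>t. f (\<zeta> t)) \<longlongrightarrow> f z) (at_right 0)"
        using \<zeta> by (rule isCont_tendsto_compose)
      have "isCont ?F z"
      proof (intro continuous_intros isCont_contour_integral_linepath_kernel)
        fix x assume x: "x \<in> I"
        show "continuous_on (closed_segment (a x) (b x)) f"
          using edge_sub[OF x] f by (meson Diff_subset continuous_on_subset holomorphic_on_imp_continuous_on order.trans)
        show "z \<notin> closed_segment (a x) (b x)" using edge_sub[OF x] z by blast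
      qed
      then have "((\<lambda>t. ?F (\<zeta> t)) \<longlongrightarrow> ?F z) (at_right 0)"
        using \<zeta> by (rule isCont_tendsto_compose)
      moreover have "\<forall>\<^sub>F t in at_right 0. ?F (\<zeta> t) = f (\<zeta> t)"
        using eventually_at_right_less[of 0] eventually_at_right_real[OF \<open>r > 0\<close>]
        by eventually_elim (use eq in auto)
      ultimately have "((\<lambda>t. f (\<zeta> t)) \<longlongrightarrow> ?F z) (at_right 0)"
        by (rule Lim_transform_eventually)
      then show ?thesis using lim_f by (rule tendsto_unique[OF trivial_limit_at_right_real])
    qed
  qed
qed

subsection \<open>Approximation by lacunary polynomials\<close>

lemma cmod_le_sup_norm_on:
  assumes "compact X" "continuous_on X f" "z \<in> X"
  shows "cmod (f z) \<le> sup_norm_on X f"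
proof -
  have "bounded ((\<lambda>z. cmod (f z)) ` X)"
    using assms by (intro compact_imp_bounded compact_continuous_image continuous_intros)
  then show ?thesis
    using assms(3) by (auto simp: sup_norm_on_def intro!: cSUP_upper bounded_imp_bdd_above)
qed

lemma sup_norm_on_nonneg:
  assumes "compact X" "continuous_on X f"
  shows "sup_norm_on X f \<ge> 0"
proof (cases "X = {}")
  case False
  then show ?thesis using cmod_le_sup_norm_on[OF assms] norm_ge_zero order.trans by blast
qed (simp add: sup_norm_on_def)

lemma sup_norm_on_le:
  assumes "B \<ge> 0" "\<And>z. z \<in> X \<Longrightarrow> cmod (f z) \<le> B"
  shows "sup_norm_on X f \<le> B"
  using assms by (auto simp: sup_norm_on_def intro!: cSUP_least)

text \<open>Since \<tau> tends to infinity, the exponent of \<open>B\<close> is o(n); a constant and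
  a subexponential factor therefore cost only part of the geometric rate.\<close>

lemma eventually_geometric_absorbs:
  fixes \<tau> :: "nat \<Rightarrow> real"
  assumes \<tau>: "\<And>n. \<tau> n > 0" "filterlim \<tau> at_top sequentially"
    and B: "B \<ge> 1" and C: "C > 0" and \<theta>: "0 < \<theta>" "\<theta> < 1"
  shows "\<forall>\<^sub>F n in sequentially. nat \<lfloor>real n / \<tau> n\<rfloor> \<le> n \<and>
    C * B ^ nat \<lfloor>real n / \<tau> n\<rfloor> * \<theta> ^ n \<le> sqrt \<theta> ^ n"
proof -
  \<comment> \<open>A quarter of the rate absorbs \<open>C\<close>, a quarter absorbs the power of
    \<open>B\<close>, and the remaining half is the rate of sqrt \<theta>.\<close>
  define l where "l = - ln \<theta> / 4"
  have l: "l > 0" using \<theta> by (simp add: l_def)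
  have ln\<theta>: "\<theta> = exp (- 4 * l)" using \<theta> by (simp add: l_def)
  have sqrt\<theta>: "sqrt \<theta> = exp (- 2 * l)"
    by (rule real_sqrt_unique) (simp_all add: ln\<theta> power2_eq_square flip: exp_add)
  have "\<forall>\<^sub>F n in sequentially. \<tau> n \<ge> max 1 (ln B / l)"
    using \<tau>(2) unfolding filterlim_at_top by blast
  moreover have "\<forall>\<^sub>F n in sequentially. real n \<ge> ln C / l"
    using filterlim_real_sequentially unfolding filterlim_at_top by blast
  ultimately show ?thesis
  proof eventually_elim
    fix n assume t: "max 1 (ln B / l) \<le> \<tau> n" and nC: "ln C / l \<le> real n"
    define m where "m = nat \<lfloor>real n / \<tau> n\<rfloor>"
    have m: "real m \<le> real n / \<tau> n" using \<tau>(1)[of n] by (simp add: m_def)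
    also have "\<dots> \<le> real n / 1" using t by (intro divide_left_mono) auto
    finally have "m \<le> n" by simp
    have "real m * ln B \<le> real n / \<tau> n * ln B" using m B by (intro mult_right_mono) auto
    also have "\<dots> \<le> real n * l"
    proof -
      have "ln B \<le> l * \<tau> n" using t l by (simp add: field_simps)
      then have "real n * ln B \<le> real n * (l * \<tau> n)" by (intro mult_left_mono) auto
      then show ?thesis using \<tau>(1)[of n] by (simp add: field_simps)
    qed
    finally have "exp (real m * ln B) \<le> exp (real n * l)" by simp
    then have "B ^ m \<le> exp (real n * l)" using B by (simp add: exp_of_nat_mult)
    moreover have "C \<le> exp (real n * l)"
      using nC l C by (metis exp_le_cancel_iff exp_ln pos_divide_le_eq)
    ultimately have "C * B ^ m * \<theta> ^ n \<le> exp (real n * l) * exp (real n * l) * exp (- 4 * l) ^ n"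
      using B C unfolding ln\<theta> by (intro mult_mono) auto
    also have "\<dots> = sqrt \<theta> ^ n"
      unfolding sqrt\<theta> exp_of_nat_mult[symmetric] exp_add[symmetric] by (simp add: algebra_simps)
    finally show "nat \<lfloor>real n / \<tau> n\<rfloor> \<le> n \<and> C * B ^ nat \<lfloor>real n / \<tau> n\<rfloor> * \<theta> ^ n \<le> sqrt \<theta> ^ n"
      using \<open>m \<le> n\<close> by (simp add: m_def)
  qed
qed

text \<open>Integrating coefficient by coefficient shows that the integral is again a polynomial in
  z of degree at most \<open>n\<close>.\<close>

lemma has_contour_integral_linepath_poly:
  assumes f: "continuous_on (closed_segment a b) f"
    and g: "\<And>k. continuous_on (closed_segment a b) (\<lambda>w. coeff (g w) k)"
    and deg: "\<And>w. w \<in> closed_segment a b \<Longrightarrow> degree (g w) \<le> n"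
  shows "((\<lambda>w. f w * poly (g w) z) has_contour_integral
    (\<Sum>k\<le>n. contour_integral (linepath a b) (\<lambda>w. f w * coeff (g w) k) * z ^ k)) (linepath a b)"
proof -
  have "((\<lambda>w. \<Sum>k\<le>n. f w * coeff (g w) k * z ^ k) has_contour_integral
    (\<Sum>k\<le>n. contour_integral (linepath a b) (\<lambda>w. f w * coeff (g w) k) * z ^ k)) (linepath a b)"
    by (intro has_contour_integral_sum has_contour_integral_rmul has_contour_integral_integral
        contour_integrable_continuous_linepath continuous_intros f g) auto
  moreover have "(\<Sum>k\<le>n. f w * coeff (g w) k * z ^ k) = f w * poly (g w) z"
    if "w \<in> path_image (linepath a b)" for w
  proof -
    have "poly (g w) z = poly (\<Sum>k\<le>n. monom (coeff (g w) k) k) z"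
      using poly_as_sum_of_monoms'[OF deg[of w]] that by simp
    then show ?thesis by (simp add: poly_sum poly_monom sum_distrib_left mult.assoc)
  qed
  ultimately show ?thesis by (rule has_contour_integral_eq)
qed

section \<open>Assembly of the lacunary polynomials\<close>

theorem theoremD:
  fixes \<tau> :: "nat \<Rightarrow> real" and K L U :: "complex set"
  assumes "\<And>n. \<tau> n > 0"
    and "filterlim \<tau> at_top sequentially"
    and "compact K" and "compact L" and "K \<inter> L = {}"
    and "0 \<notin> K"
    and "connected (- K)" and "connected (- L)"
    and "open U" and "bounded U" and "K \<subseteq> U"
  shows "\<exists>\<theta>::real. 0 < \<theta> \<and> \<theta> < 1 \<and> (\<exists>N::nat.
    \<forall>\<phi> \<in> A_space (closure U). \<forall>n\<ge>N. \<exists>a :: nat \<Rightarrow> complex.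
      (let P = (\<lambda>z::complex. \<Sum>k = nat \<lfloor>real n / \<tau> n\<rfloor>..n. a k * z ^ k) in
        sup_norm_on L P \<le> sup_norm_on (closure U) \<phi> * \<theta> ^ n \<and>
        sup_norm_on K (\<lambda>z. P z - \<phi> z) \<le> sup_norm_on (closure U) \<phi> * \<theta> ^ n))"
proof -
  \<comment> \<open>Removing \<open>L\<close> makes the Cauchy integral vanish there; removing 0
    makes \<phi> w / w^m holomorphic.\<close>
  define V where "V = U - L - {0}"
  have "open V" unfolding V_def using assms by (intro open_Diff compact_imp_closed) auto
  have "K \<subseteq> V" using assms by (auto simp: V_def)
  obtain I \<alpha> \<beta> c where I: "finite (I :: (bool \<times> int \<times> int) set)"
    and edge: "\<And>x. x \<in> I \<Longrightarrow> closed_segment (\<alpha> x) (\<beta> x) \<subseteq> V - K"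
    and cauchy_K: "\<And>f z. f holomorphic_on V \<Longrightarrow> z \<in> K \<Longrightarrow>
       (\<Sum>x\<in>I. c x * contour_integral (linepath (\<alpha> x) (\<beta> x)) (\<lambda>w. f w / (w - z))) = f z"
    and cauchy_L: "\<And>f z. f holomorphic_on V \<Longrightarrow> z \<notin> V \<Longrightarrow>
       (\<Sum>x\<in>I. c x * contour_integral (linepath (\<alpha> x) (\<beta> x)) (\<lambda>w. f w / (w - z))) = 0"
    by (rule cauchy_cycle_exists[OF \<open>compact K\<close> \<open>open V\<close> \<open>K \<subseteq> V\<close>]) (rule that; assumption)
  define \<Gamma> where "\<Gamma> = (\<Union>x\<in>I. closed_segment (\<alpha> x) (\<beta> x))"
  have "compact \<Gamma>" unfolding \<Gamma>_def using I by (intro compact_UN) auto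
  have \<Gamma>V: "\<Gamma> \<subseteq> V" using edge by (auto simp: \<Gamma>_def)
  have "\<Gamma> \<inter> K = {}" using edge by (fastforce simp: \<Gamma>_def)
  then have X: "compact (K \<union> L)" "connected (- (K \<union> L))" "\<Gamma> \<inter> (K \<union> L) = {}"
    using assms \<Gamma>V Janiszewski_connected[of K L]
    by (auto simp: V_def compact_imp_closed intro!: compact_Un simp del: Compl_Un)
  obtain C \<theta> and g :: "nat \<Rightarrow> complex \<Rightarrow> complex poly" where C: "C > 0" and \<theta>: "0 < \<theta>" "\<theta> < 1"
    and deg: "\<And>n w. w \<in> \<Gamma> \<Longrightarrow> degree (g n w) \<le> n"
    and g_cont: "\<And>n k. continuous_on \<Gamma> (\<lambda>w. coeff (g n w) k)"
    and g: "\<And>n w z. w \<in> \<Gamma> \<Longrightarrow> z \<in> K \<union> L \<Longrightarrow> cmod (1 / (w - z) - poly (g n w) z) \<le> C * \<theta> ^ n"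
    by (rule cauchy_kernel_geometric_approximation[OF X(1,2) \<open>compact \<Gamma>\<close> X(3)]) (rule that; assumption)
  have "0 \<notin> \<Gamma>" using \<Gamma>V by (auto simp: V_def)
  then obtain \<rho> where \<rho>: "\<rho> > 0" "\<And>w. w \<in> \<Gamma> \<Longrightarrow> \<rho> \<le> cmod w"
    using separate_point_closed[OF compact_imp_closed[OF \<open>compact \<Gamma>\<close>], of 0] by auto
  obtain R where R: "R > 0" "\<And>z. z \<in> K \<union> L \<Longrightarrow> cmod z \<le> R"
    using compact_imp_bounded[OF X(1)] bounded_pos by metis
  \<comment> \<open>Total weighted length of the cycle times the kernel constant; the 1 makes it
    positive.\<close>
  define D where "D = (\<Sum>x\<in>I. cmod (c x) * cmod (\<beta> x - \<alpha> x)) * C + 1"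
  have "D > 0" unfolding D_def using C by (intro add_nonneg_pos mult_nonneg_nonneg sum_nonneg) auto
  \<comment> \<open>R / \<rho> bounds |z / w|, and 1 / \<theta> compensates for the degree n - m in
    place of n. The maximum provides B \<ge> 1.\<close>
  define B where "B = max 1 (R / (\<rho> * \<theta>))"
  \<comment> \<open>\<open>N\<close> is fixed before \<phi> enters, which gives the uniformity in
    \<phi>.\<close>
  obtain N where N: "\<And>n. n \<ge> N \<Longrightarrow> nat \<lfloor>real n / \<tau> n\<rfloor> \<le> n"
      "\<And>n. n \<ge> N \<Longrightarrow> D * B ^ nat \<lfloor>real n / \<tau> n\<rfloor> * \<theta> ^ n \<le> sqrt \<theta> ^ n"
    using eventually_geometric_absorbs[OF assms(1,2) _ \<open>D > 0\<close> \<theta>, of B]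
    by (auto simp: B_def eventually_sequentially)

  \<comment> \<open>Both estimates at once: the target is \<phi> on \<open>K\<close> and 0 on
    \<open>L\<close>.\<close>
  have main: "\<exists>a. \<forall>z\<in>K \<union> L. cmod ((\<Sum>k = m..n. a k * z ^ k) - (if z \<in> K then \<phi> z else 0))
      \<le> sup_norm_on (closure U) \<phi> * sqrt \<theta> ^ n"
    if \<phi>: "\<phi> \<in> A_space (closure U)" and n: "n \<ge> N" and m: "m = nat \<lfloor>real n / \<tau> n\<rfloor>" for \<phi> n m
  proof -
    define M where "M = sup_norm_on (closure U) \<phi>"
    have cU: "compact (closure U)" and \<phi>U: "continuous_on (closure U) \<phi>"
      using \<open>bounded U\<close> \<phi> by (auto simp: A_space_def)
    have "M \<ge> 0" unfolding M_def by (rule sup_norm_on_nonneg[OF cU \<phi>U])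
    have \<phi>M: "cmod (\<phi> w) \<le> M" if "w \<in> \<Gamma>" for w
      unfolding M_def using that \<Gamma>V closure_subset[of U]
      by (intro cmod_le_sup_norm_on[OF cU \<phi>U]) (auto simp: V_def)
    define f where "f w = \<phi> w / w ^ m" for w
    have "V \<subseteq> interior (closure U)"
      using interior_maximal[OF closure_subset \<open>open U\<close>] by (auto simp: V_def)
    moreover have "\<phi> holomorphic_on interior (closure U)" using \<phi> by (simp add: A_space_def)
    ultimately have "\<phi> holomorphic_on V" by (rule holomorphic_on_subset[rotated])
    then have f: "f holomorphic_on V"
      unfolding f_def by (intro holomorphic_intros) (auto simp: V_def)
    have f_cont: "continuous_on (closed_segment (\<alpha> x) (\<beta> x)) f" if "x \<in> I" for x
      using edge[OF that] f by (meson Diff_subset continuous_on_subset holomorphic_on_imp_continuous_on order.trans)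
    have seg: "closed_segment (\<alpha> x) (\<beta> x) \<subseteq> \<Gamma>" if "x \<in> I" for x using that by (auto simp: \<Gamma>_def)
    have fM: "cmod (f w) \<le> M / \<rho> ^ m" if "w \<in> \<Gamma>" for w
      unfolding f_def norm_divide norm_power using \<phi>M[OF that] \<rho> that \<open>M \<ge> 0\<close>
      by (intro frac_le power_mono) auto
    define d where "d = n - m"
    have n_eq: "n = d + m" using N(1)[OF n] by (simp add: d_def m)
    \<comment> \<open>Coefficients of the Cauchy integral of \<open>f\<close> with the kernel
      replaced by \<open>g d w\<close>.\<close>
    define q where "q k = (\<Sum>x\<in>I. c x * contour_integral (linepath (\<alpha> x) (\<beta> x)) (\<lambda>w. f w * coeff (g d w) k))" for k
    define F where "F z = (\<Sum>x\<in>I. c x * contour_integral (linepath (\<alpha> x) (\<beta> x)) (\<lambda>w. f w / (w - z)))" for z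
    define \<epsilon> where "\<epsilon> = M / \<rho> ^ m * (C * \<theta> ^ d)"
    have "\<epsilon> \<ge> 0" using \<open>M \<ge> 0\<close> \<rho> C \<theta> by (simp add: \<epsilon>_def)

    have approx: "cmod ((\<Sum>k\<le>d. q k * z ^ k) - F z) \<le> (\<Sum>x\<in>I. cmod (c x) * cmod (\<beta> x - \<alpha> x)) * \<epsilon>"
      if z: "z \<in> K \<union> L" for z
    proof -
      define Q where "Q x = (\<Sum>k\<le>d. contour_integral (linepath (\<alpha> x) (\<beta> x)) (\<lambda>w. f w * coeff (g d w) k) * z ^ k)" for x
      define E where "E x = contour_integral (linepath (\<alpha> x) (\<beta> x)) (\<lambda>w. f w / (w - z))" for x
      have "cmod (Q x - E x) \<le> \<epsilon> * cmod (\<beta> x - \<alpha> x)" if x: "x \<in> I" for x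
      proof (rule has_contour_integral_bound_linepath[OF _ \<open>\<epsilon> \<ge> 0\<close>])
        have "continuous_on (closed_segment (\<alpha> x) (\<beta> x)) (\<lambda>w. f w / (w - z))"
          using seg[OF x] X(3) z by (intro continuous_intros f_cont x) auto
        then have "((\<lambda>w. f w / (w - z)) has_contour_integral E x) (linepath (\<alpha> x) (\<beta> x))"
          unfolding E_def by (intro has_contour_integral_integral contour_integrable_continuous_linepath)
        moreover have "((\<lambda>w. f w * poly (g d w) z) has_contour_integral Q x) (linepath (\<alpha> x) (\<beta> x))"
          unfolding Q_def using seg[OF x] deg
          by (intro has_contour_integral_linepath_poly f_cont x continuous_on_subset[OF g_cont]) auto
        ultimately show "((\<lambda>w. f w * poly (g d w) z - f w / (w - z)) has_contour_integral (Q x - E x))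
            (linepath (\<alpha> x) (\<beta> x))"
          by (rule has_contour_integral_diff[rotated])
        show "cmod (f w * poly (g d w) z - f w / (w - z)) \<le> \<epsilon>" if "w \<in> closed_segment (\<alpha> x) (\<beta> x)" for w
        proof -
          have w: "w \<in> \<Gamma>" using that seg[OF x] by blast
          have "cmod (f w * (1 / (w - z) - poly (g d w) z)) \<le> \<epsilon>"
            unfolding norm_mult \<epsilon>_def using fM[OF w] g[OF w z, of d] \<open>M \<ge> 0\<close> \<rho> by (intro mult_mono) auto
          then show ?thesis
            by (subst norm_minus_commute) (simp add: right_diff_distrib)
        qed
      qed
      then have "cmod (\<Sum>x\<in>I. c x * (Q x - E x)) \<le> (\<Sum>x\<in>I. cmod (c x) * (\<epsilon> * cmod (\<beta> x - \<alpha> x)))"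
        by (intro sum_norm_le) (auto simp: norm_mult intro!: mult_left_mono)
      moreover have "(\<Sum>k\<le>d. q k * z ^ k) = (\<Sum>x\<in>I. c x * Q x)"
        unfolding q_def Q_def sum_distrib_right sum_distrib_left
        by (subst sum.swap) (simp add: mult.assoc)
      ultimately show ?thesis
        by (simp add: F_def E_def right_diff_distrib sum_subtractf sum_distrib_left mult_ac)
    qed

    have "cmod ((\<Sum>k = m..n. q (k - m) * z ^ k) - (if z \<in> K then \<phi> z else 0)) \<le> M * sqrt \<theta> ^ n"
      if z: "z \<in> K \<union> L" for z
    proof -
      \<comment> \<open>Multiplication by z^m moves the exponents 0..d to m..n, which produces the
        lacunary form.\<close>
      have "(\<Sum>k = m..n. q (k - m) * z ^ k) = (\<Sum>k\<le>d. q k * z ^ (k + m))"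
        using sum.shift_bounds_cl_nat_ivl[of "\<lambda>k. q (k - m) * z ^ k" 0 m d]
        by (simp add: n_eq atMost_atLeast0)
      also have "\<dots> = z ^ m * (\<Sum>k\<le>d. q k * z ^ k)"
        by (simp add: sum_distrib_left power_add mult_ac)
      finally have 1: "(\<Sum>k = m..n. q (k - m) * z ^ k) = z ^ m * (\<Sum>k\<le>d. q k * z ^ k)" .
      have 2: "(if z \<in> K then \<phi> z else 0) = z ^ m * F z"
      proof (cases "z \<in> K")
        case True
        then have "F z = f z" unfolding F_def by (rule cauchy_K[OF f])
        then show ?thesis using True \<open>0 \<notin> K\<close> by (auto simp: f_def)
      next
        case False
        then have "z \<notin> V" using z by (auto simp: V_def)
        then have "F z = 0" unfolding F_def by (rule cauchy_L[OF f])
        then show ?thesis using False by simp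
      qed
      have "cmod ((\<Sum>k = m..n. q (k - m) * z ^ k) - (if z \<in> K then \<phi> z else 0))
          = cmod z ^ m * cmod ((\<Sum>k\<le>d. q k * z ^ k) - F z)"
        unfolding 1 2 by (simp add: norm_mult norm_power flip: right_diff_distrib)
      also have "\<dots> \<le> R ^ m * ((\<Sum>x\<in>I. cmod (c x) * cmod (\<beta> x - \<alpha> x)) * \<epsilon>)"
        using R z approx[OF z] by (intro mult_mono power_mono) auto
      also have "\<dots> = (D - 1) * (M * ((R / (\<rho> * \<theta>)) ^ m * \<theta> ^ n))"
        using \<theta> \<rho> by (simp add: \<epsilon>_def D_def n_eq power_add power_divide power_mult_distrib)
      also have "\<dots> \<le> D * (M * (B ^ m * \<theta> ^ n))"
        using \<open>D > 0\<close> \<open>M \<ge> 0\<close> \<theta> \<rho> R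
        by (intro mult_mono power_mono) (auto simp: B_def)
      also have "\<dots> = M * (D * B ^ m * \<theta> ^ n)" by simp
      also have "\<dots> \<le> M * sqrt \<theta> ^ n"
        using N(2)[OF n] \<open>M \<ge> 0\<close> by (intro mult_left_mono) (auto simp: m)
      finally show ?thesis .
    qed
    then show ?thesis unfolding M_def by (intro exI[of _ "\<lambda>k. q (k - m)"]) blast
  qed

  show ?thesis
  proof (intro exI[of _ "sqrt \<theta>"] exI[of _ N] conjI ballI allI impI)
    show "0 < sqrt \<theta>" "sqrt \<theta> < 1" using \<theta> by (auto simp: real_sqrt_lt_1_iff)
    fix \<phi> n assume \<phi>: "\<phi> \<in> A_space (closure U)" and n: "N \<le> n"
    define m where "m = nat \<lfloor>real n / \<tau> n\<rfloor>"
    obtain a where a: "\<And>z. z \<in> K \<union> L \<Longrightarrow>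
        cmod ((\<Sum>k = m..n. a k * z ^ k) - (if z \<in> K then \<phi> z else 0)) \<le> sup_norm_on (closure U) \<phi> * sqrt \<theta> ^ n"
      using main[OF \<phi> n m_def] by blast
    \<comment> \<open>Covers empty \<open>K\<close> or \<open>L\<close>, where
      \<open>sup_norm_on\<close> is 0.\<close>
    have nonneg: "sup_norm_on (closure U) \<phi> * sqrt \<theta> ^ n \<ge> 0"
      using \<phi> \<theta> \<open>bounded U\<close>
      by (intro mult_nonneg_nonneg sup_norm_on_nonneg) (auto simp: A_space_def)
    have "sup_norm_on L (\<lambda>z. \<Sum>k = m..n. a k * z ^ k) \<le> sup_norm_on (closure U) \<phi> * sqrt \<theta> ^ n"
    proof (rule sup_norm_on_le[OF nonneg])
      fix z assume "z \<in> L"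
      moreover have "z \<notin> K" using \<open>z \<in> L\<close> \<open>K \<inter> L = {}\<close> by blast
      ultimately show "cmod (\<Sum>k = m..n. a k * z ^ k) \<le> sup_norm_on (closure U) \<phi> * sqrt \<theta> ^ n"
        using a[of z] by simp
    qed
    moreover have "sup_norm_on K (\<lambda>z. (\<Sum>k = m..n. a k * z ^ k) - \<phi> z)
        \<le> sup_norm_on (closure U) \<phi> * sqrt \<theta> ^ n"
    proof (rule sup_norm_on_le[OF nonneg])
      fix z assume "z \<in> K"
      then show "cmod ((\<Sum>k = m..n. a k * z ^ k) - \<phi> z) \<le> sup_norm_on (closure U) \<phi> * sqrt \<theta> ^ n"
        using a[of z] by simp
    qed
    ultimately show "\<exists>a. let P = (\<lambda>z. \<Sum>k = nat \<lfloor>real n / \<tau> n\<rfloor>..n. a k * z ^ k) in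
        sup_norm_on L P \<le> sup_norm_on (closure U) \<phi> * sqrt \<theta> ^ n \<and>
        sup_norm_on K (\<lambda>z. P z - \<phi> z) \<le> sup_norm_on (closure U) \<phi> * sqrt \<theta> ^ n"
      unfolding Let_def m_def by blast
  qed
qed

end
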